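(* For every integer $n>0$, $\tilde\psi_n(y)\in\mathbb{Z}[a,d,y]$, and if $n$ is even then $(y+1)$ divides $\tilde\psi_n(y)$ (in $\mathbb{Z}[a,d,y]$).
   Context: Here $a,d,y$ are regarded as indeterminates, and the $\tilde\psi_n=\tilde\psi_n(y)$ are the elements of $\mathbb{Q}(a,d,y)$ defined recursively by $\tilde\psi_0=0$, $\tilde\psi_1=1$, $\tilde\psi_2=y+1$, $\tilde\psi_3=-dy^4-2dy^3+2ay+a$, $\tilde\psi_4=-2y(y+1)(dy^4-a)$, $$\tilde\psi_{2r+1}=\begin{cases}\dfrac{4(a-d)(a-dy^2)^2\tilde\psi_{r+2}\tilde\psi_r^3}{(y+1)^2}-\tilde\psi_{r-1}\tilde\psi_{r+1}^3 & r\equiv0\pmod 4,\ r\ge4,\\[2mm] \tilde\psi_{r+2}\tilde\psi_r^3-\dfrac{4(a-dy^2)^2\tilde\psi_{r-1}\tilde\psi_{r+1}^3}{(y+1)^2} & r\equiv1\pmod 4,\ r\ge5,\\[2mm] \dfrac{4(a-dy^2)^2\tilde\psi_{r+2}\tilde\psi_r^3}{(y+1)^2}-\tilde\psi_{r-1}\tilde\psi_{r+1}^3 & r\equiv2\pmod 4,\ r\ge2,\\[2mm] \tilde\psi_{r+2}\tilde\psi_r^3-\dfrac{4(a-d)(a-dy^2)^2\tilde\psi_{r-1}\tilde\psi_{r+1}^3}{(y+1)^2} & r\equiv3\pmod 4,\ r\ge3,\end{cases}$$ $$\tilde\psi_{2r}=\begin{cases}\dfrac{\tilde\psi_r}{y+1}\left(\tilde\psi_{r+2}\tilde\psi_{r-1}^2-\tilde\psi_{r-2}\tilde\psi_{r+1}^2\right)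 & r\equiv0,2\pmod 4,\ r\ge4,\\[2mm] \dfrac{\tilde\psi_r}{y+1}\left((a-d)\tilde\psi_{r+2}\tilde\psi_{r-1}^2-\tilde\psi_{r-2}\tilde\psi_{r+1}^2\right) & r\equiv1\pmod 4,\ r\ge5,\\[2mm] \dfrac{\tilde\psi_r}{y+1}\left(\tilde\psi_{r+2}\tilde\psi_{r-1}^2-(a-d)\tilde\psi_{r-2}\tilde\psi_{r+1}^2\right) & r\equiv3\pmod 4,\ r\ge3.\end{cases}$$ *)

theory Defs
  imports "HOL-Computational_Algebra.Computational_Algebra"
begin

text \<open>
  The ring \<open>\<int>[a, d, y]\<close> is the iterated polynomial ring with \<open>a\<close> the innermost and \<open>y\<close> the
  outermost variable. Its field of fractions is \<open>\<rat>(a, d, y)\<close>, and \<open>to_fract\<close> is the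
  inclusion of the former into the latter.
\<close>

type_synonym zady = "int poly poly poly"
type_synonym qady = "zady fract"

definition a_var :: zady where "a_var = [:[:[:0, 1:]:]:]"
definition d_var :: zady where "d_var = [:[:0, 1:]:]"
definition y_var :: zady where "y_var = [:0, 1:]"

abbreviation a_frac :: qady where "a_frac \<equiv> to_fract a_var"
abbreviation d_frac :: qady where "d_frac \<equiv> to_fract d_var"
abbreviation y_frac :: qady where "y_frac \<equiv> to_fract y_var"

function psi :: "nat \<Rightarrow> qady" where
  "psi n = (let a = a_frac; d = d_frac; y = y_frac; r = n div 2 in
     if n = 0 then 0
     else if n = 1 then 1
     else if n = 2 then y + 1
     else if n = 3 then - d * y^4 - 2 * d * y^3 + 2 * a * y + a
     else if n = 4 then - 2 * y * (y + 1) * (d * y^4 - a)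
     else if odd n then
       (if r mod 4 = 0 then
          4 * (a - d) * (a - d * y^2)^2 * psi (r + 2) * psi r ^ 3 / (y + 1)^2
            - psi (r - 1) * psi (r + 1) ^ 3
        else if r mod 4 = 1 then
          psi (r + 2) * psi r ^ 3
            - 4 * (a - d * y^2)^2 * psi (r - 1) * psi (r + 1) ^ 3 / (y + 1)^2
        else if r mod 4 = 2 then
          4 * (a - d * y^2)^2 * psi (r + 2) * psi r ^ 3 / (y + 1)^2
            - psi (r - 1) * psi (r + 1) ^ 3
        else
          psi (r + 2) * psi r ^ 3
            - 4 * (a - d) * (a - d * y^2)^2 * psi (r - 1) * psi (r + 1) ^ 3 / (y + 1)^2)
     else
       (if r mod 4 = 1 then
          psi r / (y + 1) * ((a - d) * psi (r + 2) * psi (r - 1) ^ 2 - psi (r - 2) * psi (r + 1) ^ 2)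
        else if r mod 4 = 3 then
          psi r / (y + 1) * (psi (r + 2) * psi (r - 1) ^ 2 - (a - d) * psi (r - 2) * psi (r + 1) ^ 2)
        else
          psi r / (y + 1) * (psi (r + 2) * psi (r - 1) ^ 2 - psi (r - 2) * psi (r + 1) ^ 2)))"
  by pat_completeness auto
termination
  by (relation "measure id") (auto elim!: oddE evenE)

declare psi.simps [simp del]

lemma psi_base:
  "psi 0 = 0"
  "psi 1 = 1"
  "psi 2 = y_frac + 1"
  "psi 3 = - d_frac * y_frac^4 - 2 * d_frac * y_frac^3 + 2 * a_frac * y_frac + a_frac"
  "psi 4 = - 2 * y_frac * (y_frac + 1) * (d_frac * y_frac^4 - a_frac)"
  by (simp_all add: psi.simps Let_def)

lemma psi_odd:
  "r mod 4 = 0 \<Longrightarrow> r \<ge> 4 \<Longrightarrow> psi (2 * r + 1) =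
     4 * (a_frac - d_frac) * (a_frac - d_frac * y_frac^2)^2 * psi (r + 2) * psi r ^ 3 / (y_frac + 1)^2
       - psi (r - 1) * psi (r + 1) ^ 3"
  "r mod 4 = 1 \<Longrightarrow> r \<ge> 5 \<Longrightarrow> psi (2 * r + 1) =
     psi (r + 2) * psi r ^ 3
       - 4 * (a_frac - d_frac * y_frac^2)^2 * psi (r - 1) * psi (r + 1) ^ 3 / (y_frac + 1)^2"
  "r mod 4 = 2 \<Longrightarrow> r \<ge> 2 \<Longrightarrow> psi (2 * r + 1) =
     4 * (a_frac - d_frac * y_frac^2)^2 * psi (r + 2) * psi r ^ 3 / (y_frac + 1)^2
       - psi (r - 1) * psi (r + 1) ^ 3"
  "r mod 4 = 3 \<Longrightarrow> r \<ge> 3 \<Longrightarrow> psi (2 * r + 1) =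
     psi (r + 2) * psi r ^ 3
       - 4 * (a_frac - d_frac) * (a_frac - d_frac * y_frac^2)^2 * psi (r - 1) * psi (r + 1) ^ 3
           / (y_frac + 1)^2"
  by (subst psi.simps; simp add: Let_def; fail)+

lemma psi_even:
  "r mod 4 = 0 \<or> r mod 4 = 2 \<Longrightarrow> r \<ge> 4 \<Longrightarrow> psi (2 * r) =
     psi r / (y_frac + 1) * (psi (r + 2) * psi (r - 1) ^ 2 - psi (r - 2) * psi (r + 1) ^ 2)"
  "r mod 4 = 1 \<Longrightarrow> r \<ge> 5 \<Longrightarrow> psi (2 * r) =
     psi r / (y_frac + 1)
       * ((a_frac - d_frac) * psi (r + 2) * psi (r - 1) ^ 2 - psi (r - 2) * psi (r + 1) ^ 2)"
  "r mod 4 = 3 \<Longrightarrow> r \<ge> 3 \<Longrightarrow> psi (2 * r) =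
     psi r / (y_frac + 1)
       * (psi (r + 2) * psi (r - 1) ^ 2 - (a_frac - d_frac) * psi (r - 2) * psi (r + 1) ^ 2)"
  by (subst psi.simps; auto simp add: Let_def; fail)+

end

theory Submission
  imports Defs
begin

text \<open>
  The recursion divides by \<open>y + 1\<close> or \<open>(y + 1)\<^sup>2\<close>, and divisibility of the even-indexed terms by
  \<open>y + 1\<close> pays for these denominators; conversely, the recursion reproduces that divisibility. So
  both claims are proved together by strong induction, by counting powers of \<open>y + 1\<close>.

  In an odd-indexed term \<open>\<psi>\<^sub>2\<^sub>r\<^sub>+\<^sub>1\<close>, the summand with denominator \<open>(y + 1)\<^sup>2\<close> is always the one in which
  both \<open>\<psi>\<close>-factors have even index: it is \<open>\<psi>\<^sub>r\<^sub>+\<^sub>2 \<psi>\<^sub>r\<^sup>3\<close> for even \<open>r\<close> and \<open>\<psi>\<^sub>r\<^sub>-\<^sub>1 \<psi>\<^sub>r\<^sub>+\<^sub>1\<^sup>3\<close> for odd \<open>r\<close>.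
  Its numerator therefore carries a factor \<open>(y + 1)\<^sup>4\<close>.

  In \<open>\<psi>\<^sub>2\<^sub>r\<close>, the denominator is \<open>y + 1\<close> and one further factor \<open>y + 1\<close> has to survive. If \<open>r\<close> is even,
  \<open>\<psi>\<^sub>r\<close> contributes one factor and each summand of the bracket a second one, through \<open>\<psi>\<^sub>r\<^sub>+\<^sub>2\<close> or
  \<open>\<psi>\<^sub>r\<^sub>-\<^sub>2\<close>. If \<open>r\<close> is odd, the squares \<open>\<psi>\<^sub>r\<^sub>-\<^sub>1\<^sup>2\<close> and \<open>\<psi>\<^sub>r\<^sub>+\<^sub>1\<^sup>2\<close> in the bracket contribute two.

  The factors \<open>4\<close>, \<open>a - d\<close> and \<open>(a - d y\<^sup>2)\<^sup>2\<close> lie in \<open>\<int>[a, d, y]\<close>, so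
  multiplying by them cannot lower these counts.
\<close>

text \<open>
  The ideal \<open>(y + 1)\<^sup>k \<int>[a, d, y]\<close> is taken as a subset of \<open>\<rat>(a, d, y)\<close>, so that integrality
  (the case \<open>k = 0\<close>) and divisibility by \<open>y + 1\<close> are membership statements about one and the same
  element, and division by \<open>y + 1\<close> just lowers \<open>k\<close>.
\<close>

definition y1_ideal :: "nat \<Rightarrow> qady set" where
  "y1_ideal k = range (\<lambda>p. to_fract ((y_var + 1) ^ k * p))"

lemma to_fract_power: "to_fract (p ^ m) = to_fract p ^ m"
  by (induction m) simp_all

lemma to_fract_numeral: "to_fract (numeral w) = numeral w"
  by (induction w) (simp_all only: numeral.simps to_fract_1 to_fract_add)

lemma y_frac_plus_1: "y_frac + 1 = to_fract (y_var + 1)"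
  by simp

lemma y_frac_plus_1_nonzero: "y_frac + 1 \<noteq> 0"
proof -
  have "y_var + 1 \<noteq> 0"
    by (simp add: y_var_def one_pCons)
  then show ?thesis
    by (simp only: y_frac_plus_1 to_fract_eq_0_iff not_False_eq_True)
qed

lemma to_fract_in_y1_ideal: "to_fract p \<in> y1_ideal 0"
  by (simp add: y1_ideal_def)

lemma y_frac_plus_1_in_y1_ideal: "y_frac + 1 \<in> y1_ideal 1"
  unfolding y1_ideal_def y_frac_plus_1 by (rule range_eqI[where x = 1]) simp

lemma y1_ideal_diff:
  assumes "u \<in> y1_ideal k" "v \<in> y1_ideal k"
  shows "u - v \<in> y1_ideal k"
proof -
  obtain p q where "u = to_fract ((y_var + 1) ^ k * p)" "v = to_fract ((y_var + 1) ^ k * q)"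
    using assms unfolding y1_ideal_def by blast
  then have "u - v = to_fract ((y_var + 1) ^ k * (p - q))"
    by (simp only: right_diff_distrib to_fract_diff)
  then show ?thesis
    unfolding y1_ideal_def by blast
qed

lemma y1_ideal_mult:
  assumes "u \<in> y1_ideal j" "v \<in> y1_ideal k"
  shows "u * v \<in> y1_ideal (j + k)"
proof -
  obtain p q where "u = to_fract ((y_var + 1) ^ j * p)" "v = to_fract ((y_var + 1) ^ k * q)"
    using assms unfolding y1_ideal_def by blast
  then have "u * v = to_fract ((y_var + 1) ^ (j + k) * (p * q))"
    by (simp only: power_add ac_simps flip: to_fract_mult)
  then show ?thesis
    unfolding y1_ideal_def by blast
qed

lemma y1_ideal_power:
  assumes "u \<in> y1_ideal k"
  shows "u ^ m \<in> y1_ideal (m * k)"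
proof (induction m)
  case 0
  show ?case
    using to_fract_in_y1_ideal[of 1] by simp
next
  case (Suc m)
  then show ?case
    using y1_ideal_mult[OF assms] by simp
qed

lemma y1_ideal_antimono:
  assumes "u \<in> y1_ideal k" "j \<le> k"
  shows "u \<in> y1_ideal j"
proof -
  obtain p where "u = to_fract ((y_var + 1) ^ k * p)"
    using assms(1) unfolding y1_ideal_def by blast
  also have "(y_var + 1) ^ k * p = (y_var + 1) ^ j * ((y_var + 1) ^ (k - j) * p)"
    using assms(2) by (simp flip: power_add mult.assoc)
  finally show ?thesis
    unfolding y1_ideal_def by blast
qed

lemma y1_ideal_divide:
  assumes "u \<in> y1_ideal (j + k)"
  shows "u / (y_frac + 1) ^ j \<in> y1_ideal k"
proof -
  obtain p where "u = to_fract ((y_var + 1) ^ (j + k) * p)"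
    using assms unfolding y1_ideal_def by blast
  then have "u = (y_frac + 1) ^ j * to_fract ((y_var + 1) ^ k * p)"
    by (simp only: y_frac_plus_1 power_add mult.assoc to_fract_power to_fract_mult)
  then have "u / (y_frac + 1) ^ j = to_fract ((y_var + 1) ^ k * p)"
    using y_frac_plus_1_nonzero by simp
  then show ?thesis
    unfolding y1_ideal_def by blast
qed

text \<open>
  In the recursion for odd indices, \<open>u\<close> and \<open>v\<close> are the two terms of even index: the denominator
  \<open>(y + 1)\<^sup>2\<close> is cancelled by the four factors in the numerator.
\<close>

lemma fractional_summand_in_y1_ideal:
  assumes "c \<in> y1_ideal 0" "u \<in> y1_ideal 1" "v \<in> y1_ideal 1"
  shows "c * u * v ^ 3 / (y_frac + 1) ^ 2 \<in> y1_ideal 0"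
proof -
  have "c * u * v ^ 3 \<in> y1_ideal (0 + 1 + 3 * 1)"
    by (intro y1_ideal_mult y1_ideal_power assms)
  then have "c * u * v ^ 3 \<in> y1_ideal (2 + 0)"
    by (rule y1_ideal_antimono) simp
  then show ?thesis
    by (rule y1_ideal_divide)
qed

text \<open>
  The shape of the recursion for even indices: \<open>x\<close> stands for \<open>\<psi>\<^sub>r\<close>, and \<open>(i, k)\<close> is \<open>(1, 1)\<close> for even
  \<open>r\<close> and \<open>(0, 2)\<close> for odd \<open>r\<close>. Either way one of the two factors \<open>y + 1\<close> survives the division.
\<close>

lemma even_term_in_y1_ideal:
  assumes "x \<in> y1_ideal i" "2 \<le> i + k"
    and "c * u * v ^ 2 \<in> y1_ideal k" "c' * u' * v' ^ 2 \<in> y1_ideal k"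
  shows "x / (y_frac + 1) * (c * u * v ^ 2 - c' * u' * v' ^ 2) \<in> y1_ideal 1"
proof -
  have "x * (c * u * v ^ 2 - c' * u' * v' ^ 2) \<in> y1_ideal (i + k)"
    by (intro y1_ideal_mult y1_ideal_diff assms)
  then have "x * (c * u * v ^ 2 - c' * u' * v' ^ 2) \<in> y1_ideal (1 + 1)"
    by (rule y1_ideal_antimono) (use assms(2) in linarith)
  from y1_ideal_divide[OF this] show ?thesis
    by simp
qed

lemma psi_in_y1_ideal: "psi n \<in> y1_ideal (if even n then 1 else 0)"
proof (induction n rule: less_induct)
  case (less n)
  have coeffs:
    "1 \<in> y1_ideal 0"
    "a_frac - d_frac \<in> y1_ideal 0"
    "4 * (a_frac - d_frac * y_frac ^ 2) ^ 2 \<in> y1_ideal 0"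
    "4 * (a_frac - d_frac) * (a_frac - d_frac * y_frac ^ 2) ^ 2 \<in> y1_ideal 0"
  proof -
    show "1 \<in> y1_ideal 0"
      using to_fract_in_y1_ideal[of 1] by simp
    show "a_frac - d_frac \<in> y1_ideal 0"
      using to_fract_in_y1_ideal[of "a_var - d_var"] by simp
    show "4 * (a_frac - d_frac * y_frac ^ 2) ^ 2 \<in> y1_ideal 0"
      using to_fract_in_y1_ideal[of "4 * (a_var - d_var * y_var ^ 2) ^ 2"]
      by (simp add: to_fract_power to_fract_numeral)
    show "4 * (a_frac - d_frac) * (a_frac - d_frac * y_frac ^ 2) ^ 2 \<in> y1_ideal 0"
      using to_fract_in_y1_ideal[of "4 * (a_var - d_var) * (a_var - d_var * y_var ^ 2) ^ 2"]
      by (simp add: to_fract_power to_fract_numeral)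
  qed
  have even_IH: "psi m \<in> y1_ideal 1" if "m < n" "even m" for m
    using less.IH[OF that(1)] that(2) by simp
  have IH: "psi m \<in> y1_ideal 0" if "m < n" for m
    using y1_ideal_antimono[OF less.IH[OF that]] by simp
  consider "n = 0" | "n = 1" | "n = 2" | "n = 3" | "n = 4"
    | (odd) r where "n = 2 * r + 1" "r \<ge> 2" | (even) r where "n = 2 * r" "r \<ge> 3"
  proof -
    have "n = 2 * (n div 2) + 1 \<or> n = 2 * (n div 2)"
      by presburger
    then show ?thesis
      using that(1-5) that(6,7)[of "n div 2"] by linarith
  qed
  then show ?case
  proof cases
    case 1
    then show ?thesis
      using y1_ideal_mult[OF to_fract_in_y1_ideal[of 0] y_frac_plus_1_in_y1_ideal]
      by (simp add: psi_base)
  next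
    case 2
    then show ?thesis
      using coeffs(1) psi_base(2) by simp
  next
    case 3
    then show ?thesis
      using y_frac_plus_1_in_y1_ideal by (simp add: psi_base)
  next
    case 4
    then show ?thesis
      using to_fract_in_y1_ideal[of "- d_var * y_var ^ 4 - 2 * d_var * y_var ^ 3
        + 2 * a_var * y_var + a_var"]
      by (simp add: psi_base to_fract_power to_fract_numeral)
  next
    case 5
    have "to_fract (- 2 * y_var * (d_var * y_var ^ 4 - a_var)) * (y_frac + 1) \<in> y1_ideal (0 + 1)"
      by (intro y1_ideal_mult to_fract_in_y1_ideal y_frac_plus_1_in_y1_ideal)
    then show ?thesis
      using 5 by (simp add: psi_base to_fract_power to_fract_numeral algebra_simps)
  next
    case (odd r)
    have integral_summand: "psi i * psi j ^ 3 \<in> y1_ideal 0" if "i < n" "j < n" for i j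
      using y1_ideal_mult[OF IH[OF that(1)] y1_ideal_power[OF IH[OF that(2)], of 3]] by simp
    have fractional_summand: "c * psi i * psi j ^ 3 / (y_frac + 1) ^ 2 \<in> y1_ideal 0"
      if "c \<in> y1_ideal 0" "i < n" "j < n" "even i" "even j" for c i j
      by (intro fractional_summand_in_y1_ideal even_IH that)
    consider "r mod 4 = 0" "r \<ge> 4" "even r" | "r mod 4 = 1" "r \<ge> 5" "odd r"
      | "r mod 4 = 2" "even r" | "r mod 4 = 3" "r \<ge> 3" "odd r"
    proof -
      have "r mod 4 = 0 \<and> r \<ge> 4 \<and> even r \<or> r mod 4 = 1 \<and> r \<ge> 5 \<and> odd r
        \<or> r mod 4 = 2 \<and> even r \<or> r mod 4 = 3 \<and> r \<ge> 3 \<and> odd r"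
        using odd(2) by presburger
      then show ?thesis
        using that by metis
    qed
    then have "psi (2 * r + 1) \<in> y1_ideal 0"
    proof cases
      case 1
      then show ?thesis
        unfolding psi_odd(1)[OF 1(1,2)] using odd
        by (intro y1_ideal_diff fractional_summand integral_summand coeffs) auto
    next
      case 2
      then show ?thesis
        unfolding psi_odd(2)[OF 2(1,2)] using odd
        by (intro y1_ideal_diff fractional_summand integral_summand coeffs) auto
    next
      case 3
      then show ?thesis
        unfolding psi_odd(3)[OF 3(1) odd(2)] using odd
        by (intro y1_ideal_diff fractional_summand integral_summand coeffs) auto
    next
      case 4
      then show ?thesis
        unfolding psi_odd(4)[OF 4(1,2)] using odd
        by (intro y1_ideal_diff fractional_summand integral_summand coeffs) auto
    qed
    then show ?thesis
      using odd(1) by simp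
  next
    case (even r)
    \<comment> \<open>In a bracket summand \<open>c \<psi>\<^sub>i \<psi>\<^sub>j\<^sup>2\<close>, the even index is \<open>i\<close> if \<open>r\<close> is even and \<open>j\<close> if \<open>r\<close> is odd. Where the
       recursion shows no coefficient, \<open>c = 1\<close> is written out below to bring the summand into this form.\<close>
    have bracket_even: "c * psi i * psi j ^ 2 \<in> y1_ideal 1"
      if "c \<in> y1_ideal 0" "i < n" "j < n" "even i" for c i j
      using y1_ideal_mult[OF y1_ideal_mult[OF that(1) even_IH[OF that(2,4)]]
          y1_ideal_power[OF IH[OF that(3)], of 2]]
      by simp
    have bracket_odd: "c * psi i * psi j ^ 2 \<in> y1_ideal 2"
      if "c \<in> y1_ideal 0" "i < n" "j < n" "even j" for c i j
      using y1_ideal_mult[OF y1_ideal_mult[OF that(1) IH[OF that(2)]]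
          y1_ideal_power[OF even_IH[OF that(3,4)], of 2]]
      by (simp add: numeral_2_eq_2)
    consider "r mod 4 = 0 \<or> r mod 4 = 2" "r \<ge> 4" "even r" | "r mod 4 = 1" "r \<ge> 5" "odd r"
      | "r mod 4 = 3" "odd r"
    proof -
      have "(r mod 4 = 0 \<or> r mod 4 = 2) \<and> r \<ge> 4 \<and> even r \<or> r mod 4 = 1 \<and> r \<ge> 5 \<and> odd r
        \<or> r mod 4 = 3 \<and> odd r"
        using even(2) by presburger
      then show ?thesis
        using that by metis
    qed
    then have "psi (2 * r) \<in> y1_ideal 1"
    proof cases
      case 1
      have "psi r / (y_frac + 1)
          * (1 * psi (r + 2) * psi (r - 1) ^ 2 - 1 * psi (r - 2) * psi (r + 1) ^ 2) \<in> y1_ideal 1"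
        by (rule even_term_in_y1_ideal[where i = 1 and k = 1]; (intro even_IH bracket_even coeffs)?)
          (use 1 even in auto)
      then show ?thesis
        unfolding psi_even(1)[OF 1(1,2)] by simp
    next
      case 2
      have "psi r / (y_frac + 1) * ((a_frac - d_frac) * psi (r + 2) * psi (r - 1) ^ 2
          - 1 * psi (r - 2) * psi (r + 1) ^ 2) \<in> y1_ideal 1"
        by (rule even_term_in_y1_ideal[where i = 0 and k = 2]; (intro IH bracket_odd coeffs)?)
          (use 2 even in auto)
      then show ?thesis
        unfolding psi_even(2)[OF 2(1,2)] by simp
    next
      case 3
      have "psi r / (y_frac + 1) * (1 * psi (r + 2) * psi (r - 1) ^ 2
          - (a_frac - d_frac) * psi (r - 2) * psi (r + 1) ^ 2) \<in> y1_ideal 1"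
        by (rule even_term_in_y1_ideal[where i = 0 and k = 2]; (intro IH bracket_odd coeffs)?)
          (use 3 even in auto)
      then show ?thesis
        unfolding psi_even(3)[OF 3(1) even(2)] by simp
    qed
    then show ?thesis
      using even(1) by simp
  qed
qed

theorem theorem7p1:
  fixes n :: nat
  assumes "n > 0"
  shows "\<exists>p :: zady. psi n = to_fract p \<and> (even n \<longrightarrow> y_var + 1 dvd p)"
proof -
  obtain q where "psi n = to_fract ((y_var + 1) ^ (if even n then 1 else 0) * q)"
    using psi_in_y1_ideal[of n] unfolding y1_ideal_def by blast
  then show ?thesis
    by (intro exI[of _ "(y_var + 1) ^ (if even n then 1 else 0) * q"]) simp
qed

end
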